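(* Let $n=4$, $\lambda<0$ and $R>0$. Then the condition $\mathrm{PCFB}(R)$ (the explicit pointwise condition for finite-time breakdown for $n=4$ written out in the context) holds if and only if one of the following conditions holds: (1) $A(R)=0$ and $v_0(R)<0$; (2) $\partial_rC(R)<0$; (3) $\partial_rC(R)=0$ and $v_0(R)+v_0'(R)R<0$; (4) $\partial_rC(R)>0$ and $v_0(R)+v_0'(R)R\le-\sqrt{2R\,\partial_rC(R)}$.
   Context: Data: $\rho_0\in C([0,\infty))$, $\rho_0\ge0$; $v_0\in C([0,\infty))\cap C^1((0,\infty))$ with $v_0(0)=0$. For $n=4$: $m_0(r)=\int_0^r\rho_0(s)s^3ds$, $A(r)=|\lambda|m_0(r)$, $C(r)=v_0(r)^2+A(r)r^{-2}$. $\mathrm{PCFB}(R)$ is the explicit form, for $n=4$, of the necessary and sufficient condition for the existence of $t_c\in(0,\infty)$ with $X(t_c,R)=0$ or $\partial_RX(t_c,R)=0$, where $X''(t,R)=-\lambda m_0(R)/X(t,R)^{3}$, $X'(0,R)=v_0(R)$, $X(0,R)=R$. Explicitly (all quantities at $R$): If $v_0>0$: (i) $\partial_rC<0$; or (ii) $\partial_rC=0$ and $\frac1{v_0}-\frac{\partial_rA}2\int_R^\infty\frac{y^{-2}}{(C-Ay^{-2})^{3/2}}dy<0$; or (iii) $0<\partial_rC<\partial_rA\,R^{-2}$ and $\frac1{v_0}+\frac12\int_R^{(\partial_rA/\partial_rC)^{1/2}}\frac{\partial_rC-\partial_rA\,y^{-2}}{(C-Ay^{-2})^{3/2}}dy\le0$.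 If $v_0=0$: (i) $\partial_rC<0$; or (ii) $\partial_rC=0$ and $v_0'R<0$; or (iii) $\partial_rC>0$ and $v_0'R\le-\sqrt{2R\partial_rC}$. If $v_0<0$: $A=0$; or, with $t_*(R)=\big(A(R)C(R)^{-2}\big)^{1/2}\int_1^{R(A(R)/C(R))^{-1/2}}\frac{dz}{\sqrt{1-z^{-2}}}$, one of: (i) $\partial_rC<0$; (ii) $\partial_rC=0$ and $\frac1{|v_0|}-\frac12\int_R^\infty\frac{\partial_rA\,y^{-2}}{(C-Ay^{-2})^{3/2}}dy<2\partial_rt_*$; (iii) $0<\partial_rC\le\partial_rA\,R^{-2}$ and $\frac1{|v_0|}+\frac12\int_R^{(\partial_rA/\partial_rC)^{1/2}}\frac{\partial_rC-\partial_rA\,y^{-2}}{(C-Ay^{-2})^{3/2}}dy\le2\partial_rt_*$; (iv) $\partial_rA\,R^{-2}<\partial_rC<\partial_rA(R^{-2}+v_0^2/A)$ and $\frac1{|v_0|}+\frac12\int_R^{(\partial_rA/\partial_rC)^{1/2}}\frac{\partial_rC-\partial_rA\,y^{-2}}{(C-Ay^{-2})^{3/2}}dy\le\max(0,2\partial_rt_* )$; (v) $\partial_rA(R^{-2}+v_0^2/A)\le\partial_rC$. *)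

theory Defs
  imports "HOL-Analysis.Analysis"
begin

(* Radial Euler-Poisson data in dimension n = 4: coupling constant lam, initial density rho0,
   initial radial velocity v0.  The functions below are only meaningful for positive radii. *)

definition mass0 :: "(real \<Rightarrow> real) \<Rightarrow> real \<Rightarrow> real" where
  "mass0 rho0 r = (LBINT s=0..ereal r. rho0 s * s ^ 3)"

definition A_fun :: "real \<Rightarrow> (real \<Rightarrow> real) \<Rightarrow> real \<Rightarrow> real" where
  "A_fun lam rho0 r = \<bar>lam\<bar> * mass0 rho0 r"

definition C_fun :: "real \<Rightarrow> (real \<Rightarrow> real) \<Rightarrow> (real \<Rightarrow> real) \<Rightarrow> real \<Rightarrow> real" where
  "C_fun lam rho0 v0 r = (v0 r)\<^sup>2 + A_fun lam rho0 r / r\<^sup>2"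

(* Used only where v0 r < 0 and A r > 0, so that A / C > 0 and the upper limit exceeds 1. *)
definition t_star :: "real \<Rightarrow> (real \<Rightarrow> real) \<Rightarrow> (real \<Rightarrow> real) \<Rightarrow> real \<Rightarrow> real" where
  "t_star lam rho0 v0 r =
     (let A = A_fun lam rho0 r; C = C_fun lam rho0 v0 r
      in sqrt (A / C\<^sup>2) * (LBINT z=1..ereal (r * (A / C) powr (-1/2)). 1 / sqrt (1 - 1 / z\<^sup>2)))"

(* A, C, A', C' are the values at R of A, C and their radial derivatives.  LBINT y=a..b is
   oriented, which matters in case (iv) for v0 R < 0, where sqrt (A' / C') < R. *)
definition PCFB :: "real \<Rightarrow> (real \<Rightarrow> real) \<Rightarrow> (real \<Rightarrow> real) \<Rightarrow> real \<Rightarrow> bool" where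
  "PCFB lam rho0 v0 R \<longleftrightarrow>
    (let v = v0 R; v' = deriv v0 R;
         A = A_fun lam rho0 R; A' = deriv (A_fun lam rho0) R;
         C = C_fun lam rho0 v0 R; C' = deriv (C_fun lam rho0 v0) R;
         t' = deriv (t_star lam rho0 v0) R
     in
      v > 0 \<and>
        (C' < 0 \<or>
         C' = 0 \<and>
           1 / v - A' / 2 * (LBINT y=ereal R..\<infinity>. (1 / y\<^sup>2) / (C - A / y\<^sup>2) powr (3/2)) < 0 \<or>
         0 < C' \<and> C' < A' / R\<^sup>2 \<and>
           1 / v + 1 / 2 * (LBINT y=ereal R..ereal (sqrt (A' / C')).
             (C' - A' / y\<^sup>2) / (C - A / y\<^sup>2) powr (3/2)) \<le> 0)
      \<or> v = 0 \<and>
        (C' < 0 \<or>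
         C' = 0 \<and> v' * R < 0 \<or>
         C' > 0 \<and> v' * R \<le> - sqrt (2 * R * C'))
      \<or> v < 0 \<and>
        (A = 0 \<or>
         C' < 0 \<or>
         C' = 0 \<and>
           1 / \<bar>v\<bar> - 1 / 2 * (LBINT y=ereal R..\<infinity>. (A' / y\<^sup>2) / (C - A / y\<^sup>2) powr (3/2)) < 2 * t' \<or>
         0 < C' \<and> C' \<le> A' / R\<^sup>2 \<and>
           1 / \<bar>v\<bar> + 1 / 2 * (LBINT y=ereal R..ereal (sqrt (A' / C')).
             (C' - A' / y\<^sup>2) / (C - A / y\<^sup>2) powr (3/2)) \<le> 2 * t' \<or>
         A' / R\<^sup>2 < C' \<and> C' < A' * (1 / R\<^sup>2 + v\<^sup>2 / A) \<and>
           1 / \<bar>v\<bar> + 1 / 2 * (LBINT y=ereal R..ereal (sqrt (A' / C')).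
             (C' - A' / y\<^sup>2) / (C - A / y\<^sup>2) powr (3/2)) \<le> max 0 (2 * t') \<or>
         A' * (1 / R\<^sup>2 + v\<^sup>2 / A) \<le> C'))"

end

theory Submission
  imports Defs
begin

text \<open>
  All integrals are elementary. With \<open>s y = y * sqrt (C - A / y\<^sup>2)\<close>, the breakdown integrand has the
  primitive \<open>C' / C\<^sup>2 * (s - A / s) + A' / (C * s)\<close>, and \<open>t_star r = - r * v0 r / C r\<close> where
  \<open>v0 < 0 < A\<close>. Put \<open>w = \<bar>v\<bar>\<close>, \<open>q = v + v' R\<close>, \<open>\<sigma> = C A' / C' - A\<close> (the value of \<open>s\<^sup>2\<close> at the
  critical point \<open>sqrt (A' / C')\<close>) and \<open>K = C * sqrt (2 R / C')\<close>. For \<open>C' > 0\<close>, up to positive factors,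
  \<^item> \<open>v * (q + sqrt (2 R C'))\<close> is \<open>(K + R v)\<^sup>2 - \<sigma>\<close>;
  \<^item> the left-hand side of the integral condition is \<open>K\<^sup>2 - (sqrt \<sigma> - R w)\<^sup>2\<close>;
  \<^item> that left-hand side minus \<open>2 t_star'\<close> is \<open>(sqrt \<sigma> + R w)\<^sup>2 - K\<^sup>2\<close>.

  The equivalence is then a comparison of \<open>K\<close>, \<open>R w\<close> and \<open>sqrt \<sigma>\<close>; the last subcase of \<open>v0 < 0\<close> is
  \<open>\<sigma> \<le> 0\<close>.
\<close>

section \<open>Primitive of the breakdown integrand\<close>

lemma powr_three_halves:
  fixes x :: real
  assumes "x > 0"
  shows "x powr (3/2) = sqrt x ^ 3"
proof -
  have "x powr (3/2) = x powr (1 + 1/2)"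
    by simp
  also have "\<dots> = x * sqrt x"
    using assms unfolding powr_add by (simp add: powr_half_sqrt)
  also have "\<dots> = sqrt x ^ 3"
    using assms by (simp add: power3_eq_cube)
  finally show ?thesis .
qed

lemma radicand_pos:
  fixes A C y z :: real
  assumes "A \<ge> 0" "0 < y" "y \<le> z" "C - A / y\<^sup>2 > 0"
  shows "C - A / z\<^sup>2 > 0"
proof -
  have "y\<^sup>2 \<le> z\<^sup>2"
    using assms by (intro power_mono) auto
  then have "A / z\<^sup>2 \<le> A / y\<^sup>2"
    using assms by (intro divide_left_mono) auto
  with assms show ?thesis by linarith
qed

text \<open>With \<open>s = y * sqrt (C - A / y\<^sup>2)\<close> one has
  \<open>s\<^sup>2 = C * y\<^sup>2 - A\<close>, hence \<open>s * s' = C * y\<close>.\<close>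

lemma has_real_derivative_mult_sqrt:
  fixes A C y :: real
  assumes "y > 0" "C - A / y\<^sup>2 > 0"
  shows "((\<lambda>y. y * sqrt (C - A / y\<^sup>2)) has_real_derivative C / sqrt (C - A / y\<^sup>2)) (at y)"
proof -
  define q where "q = sqrt (C - A / y\<^sup>2)"
  have q: "q > 0" "C = q\<^sup>2 + A / y\<^sup>2"
    using assms by (auto simp: q_def)
  have "((\<lambda>y. C - A / y\<^sup>2) has_real_derivative 2 * A / y ^ 3) (at y)"
    using assms by (auto intro!: derivative_eq_intros simp: field_simps power_numeral_reduce)
  from DERIV_chain2[where f = sqrt and g = "\<lambda>y. C - A / y\<^sup>2", OF DERIV_real_sqrt[OF assms(2)] this]
  have "((\<lambda>y. sqrt (C - A / y\<^sup>2)) has_real_derivative inverse q / 2 * (2 * A / y ^ 3)) (at y)"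
    by (simp add: q_def)
  from DERIV_mult[OF DERIV_ident this]
  have "((\<lambda>y. y * sqrt (C - A / y\<^sup>2)) has_real_derivative
      1 * q + inverse q / 2 * (2 * A / y ^ 3) * y) (at y)"
    by (simp add: q_def)
  moreover have "1 * q + inverse q / 2 * (2 * A / y ^ 3) * y = (q\<^sup>2 + A / y\<^sup>2) / q"
    using q(1) assms(1) by (simp add: field_simps power_numeral_reduce)
  ultimately show ?thesis
    by (simp only: q(2)[symmetric]) (simp only: q_def)
qed

text \<open>With \<open>q = sqrt (C - A / y\<^sup>2)\<close>, \<open>s = y * q\<close> and
  \<open>s' = C / q\<close>, one gets \<open>s' * (1 + A / s\<^sup>2) = C\<^sup>2 / q ^ 3\<close>
  and \<open>s' / s\<^sup>2 = C / (y\<^sup>2 * q ^ 3)\<close>. These produce the \<open>c\<close>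
  part and the \<open>a\<close> part of the integrand separately.\<close>

lemma has_real_derivative_primitive:
  fixes A C a c y :: real
  assumes "y > 0" "C > 0" "C - A / y\<^sup>2 > 0"
  defines "s \<equiv> \<lambda>y. y * sqrt (C - A / y\<^sup>2)"
  shows "((\<lambda>y. c / C\<^sup>2 * (s y - A / s y) + a / (C * s y)) has_real_derivative
    (c - a / y\<^sup>2) / (C - A / y\<^sup>2) powr (3/2)) (at y)"
proof -
  define q where "q = sqrt (C - A / y\<^sup>2)"
  have q: "q > 0" "C = q\<^sup>2 + A / y\<^sup>2" and s: "s y = y * q"
    using assms by (auto simp: q_def)
  have D: "(s has_real_derivative C / q) (at y)"
    using has_real_derivative_mult_sqrt[OF assms(1,3)] by (simp add: s_def q_def)
  have "s y \<noteq> 0"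
    using q assms s by simp
  from DERIV_inverse_fun[OF D this]
  have I: "((\<lambda>y. inverse (s y)) has_real_derivative - (C / q / (y * q)\<^sup>2)) (at y)"
    by (simp add: s field_simps power2_eq_square)
  have 1: "((\<lambda>y. c / C\<^sup>2 * (s y - A * inverse (s y)) + a / C * inverse (s y)) has_real_derivative
      c / C\<^sup>2 * (C / q - A * - (C / q / (y * q)\<^sup>2)) + a / C * - (C / q / (y * q)\<^sup>2)) (at y)"
    by (intro DERIV_add DERIV_diff DERIV_cmult D I)
  have 2: "(\<lambda>y. c / C\<^sup>2 * (s y - A * inverse (s y)) + a / C * inverse (s y))
      = (\<lambda>y. c / C\<^sup>2 * (s y - A / s y) + a / (C * s y))"
    by (simp add: divide_inverse mult.assoc)
  have 3: "c / C\<^sup>2 * (C / q - A * - (C / q / (y * q)\<^sup>2)) + a / C * - (C / q / (y * q)\<^sup>2)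
      = c / C * ((q\<^sup>2 + A / y\<^sup>2) / q ^ 3) - a / y\<^sup>2 / q ^ 3"
    using q(1) assms(1,2)
    by (simp add: field_simps power2_eq_square power3_eq_cube)
  have 4: "c / C * ((q\<^sup>2 + A / y\<^sup>2) / q ^ 3) - a / y\<^sup>2 / q ^ 3 = (c - a / y\<^sup>2) / q ^ 3"
    using \<open>C > 0\<close> by (simp add: q(2)[symmetric] diff_divide_distrib)
  have 5: "(C - A / y\<^sup>2) powr (3/2) = q ^ 3"
    using powr_three_halves[OF assms(3)] by (simp add: q_def)
  show ?thesis
    unfolding 5 using 1[unfolded 2 3 4] .
qed

section \<open>Closed forms of the integrals\<close>

lemma isCont_integrand:
  fixes A C a c y :: real
  assumes "y > 0" "C - A / y\<^sup>2 > 0"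
  shows "isCont (\<lambda>y. (c - a / y\<^sup>2) / (C - A / y\<^sup>2) powr (3/2)) y"
  using assms by (intro continuous_intros) auto

text \<open>The upper limit is the zero of the numerator. There the factor
  \<open>y * sqrt (C - A / y\<^sup>2)\<close> equals \<open>s\<close>, and
  \<open>s\<^sup>2 + A = C * a / c\<close> merges the terms of the primitive into
  \<open>2 * c * s / C\<^sup>2\<close>. The limit may lie on either side of
  \<open>R\<close>.\<close>

lemma LBINT_to_critical_point:
  fixes A C a c R :: real
  assumes "A \<ge> 0" "C > 0" "R > 0" "c > 0" "a > 0"
    and "C - A / R\<^sup>2 > 0" "C * a / c - A > 0"
  defines "s \<equiv> sqrt (C * a / c - A)" and "w \<equiv> sqrt (C - A / R\<^sup>2)"
  shows "(LBINT y=ereal R..ereal (sqrt (a / c)). (c - a / y\<^sup>2) / (C - A / y\<^sup>2) powr (3/2))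
    = 2 * c * s / C\<^sup>2 - c / C\<^sup>2 * (R * w - A / (R * w)) - a / (C * R * w)"
proof -
  define b where "b = sqrt (a / c)"
  have b: "b > 0" "b\<^sup>2 = a / c"
    using assms by (auto simp: b_def)
  have "C - A / b\<^sup>2 = (C * a / c - A) / b\<^sup>2"
    using assms b by (simp add: field_simps)
  moreover from this have "sqrt (C - A / b\<^sup>2) = s / b"
    using b(1) by (simp only: real_sqrt_divide s_def real_sqrt_abs abs_of_pos)
  ultimately have b3: "C - A / b\<^sup>2 > 0" and bs: "b * sqrt (C - A / b\<^sup>2) = s"
    using assms(7) b(1) by auto
  \<comment> \<open>The radicand increases with \<open>y\<close>, so positivity at the smaller
    endpoint suffices. Taking \<open>min R b\<close> treats both orientations of the integral at
    once.\<close>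
  have pos: "y > 0" "C - A / y\<^sup>2 > 0" if "min R b \<le> y" for y
  proof -
    show "y > 0" using that b assms by auto
    show "C - A / y\<^sup>2 > 0"
      using radicand_pos[of A "min R b" y C] that assms b b3 by (auto simp: min_def split: if_splits)
  qed
  define F where "F = (\<lambda>y. c / C\<^sup>2 * (y * sqrt (C - A / y\<^sup>2) - A / (y * sqrt (C - A / y\<^sup>2)))
      + a / (C * (y * sqrt (C - A / y\<^sup>2))))"
  have "(LBINT y=ereal R..ereal b. (c - a / y\<^sup>2) / (C - A / y\<^sup>2) powr (3/2)) = F b - F R"
  proof (rule interval_integral_FTC_finite)
    have "isCont (\<lambda>y. (c - a / y\<^sup>2) / (C - A / y\<^sup>2) powr (3/2)) y" if "min R b \<le> y" for y
      using isCont_integrand[OF pos[OF that]] .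
    then show "continuous_on {min R b..max R b} (\<lambda>y. (c - a / y\<^sup>2) / (C - A / y\<^sup>2) powr (3/2))"
      by (meson atLeastAtMost_iff continuous_at_imp_continuous_on)
    fix y assume "min R b \<le> y"
    then have "(F has_real_derivative (c - a / y\<^sup>2) / (C - A / y\<^sup>2) powr (3/2)) (at y)"
      using has_real_derivative_primitive[OF pos(1) assms(2) pos(2), of y] unfolding F_def by blast
    then show "(F has_vector_derivative (c - a / y\<^sup>2) / (C - A / y\<^sup>2) powr (3/2))
        (at y within {min R b..max R b})"
      by (metis has_real_derivative_iff_has_vector_derivative has_field_derivative_at_within)
  qed
  moreover have "F b = 2 * c * s / C\<^sup>2"
  proof -
    have s: "s > 0" "s\<^sup>2 = C * a / c - A"
      using assms by (auto simp: s_def)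
    have "F b = c / C\<^sup>2 * (s - A / s) + a / (C * s)"
      by (simp add: F_def bs)
    also have "\<dots> = c / (C\<^sup>2 * s) * (s\<^sup>2 - A + C * a / c)"
      using s(1) assms(2,4) by (simp add: field_simps power_numeral_reduce)
    also have "s\<^sup>2 - A + C * a / c = 2 * s\<^sup>2"
      using s(2) by simp
    finally show ?thesis
      using s(1) by (simp add: power2_eq_square)
  qed
  moreover have "F R = c / C\<^sup>2 * (R * w - A / (R * w)) + a / (C * R * w)"
    by (simp only: F_def w_def mult.assoc)
  ultimately show ?thesis
    unfolding b_def by linarith
qed

text \<open>Only the \<open>a\<close> part of the primitive is present. It vanishes at infinity
  because \<open>sqrt (C - A / y\<^sup>2)\<close> tends to \<open>sqrt C > 0\<close>, and
  nonnegativity of the integrand permits the improper form of the fundamental theorem.\<close>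

lemma LBINT_to_infinity:
  fixes A C a R :: real
  assumes "A \<ge> 0" "C > 0" "R > 0" "a \<ge> 0" "C - A / R\<^sup>2 > 0"
  shows "(LBINT y=ereal R..\<infinity>. (a / y\<^sup>2) / (C - A / y\<^sup>2) powr (3/2))
    = a / (C * R * sqrt (C - A / R\<^sup>2))"
proof -
  have pos: "y > 0" "C - A / y\<^sup>2 > 0" if "R \<le> y" for y
    using radicand_pos[of A R y C] that assms by auto
  define F where "F = (\<lambda>y. - (a / (C * (y * sqrt (C - A / y\<^sup>2)))))"
  have DF: "(F has_real_derivative (a / y\<^sup>2) / (C - A / y\<^sup>2) powr (3/2)) (at y)" if "R \<le> y" for y
    using has_real_derivative_primitive[of y C A 0 "-a"] pos[OF that] assms by (simp add: F_def)
  have "(LBINT y=ereal R..\<infinity>. (a / y\<^sup>2) / (C - A / y\<^sup>2) powr (3/2)) = 0 - F R"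
  proof (rule interval_integral_FTC_nonneg(2))
    show "isCont (\<lambda>y. (a / y\<^sup>2) / (C - A / y\<^sup>2) powr (3/2)) y" if "ereal R < ereal y" for y
      using isCont_integrand[of y C A 0 "-a"] pos[of y] that by simp
    show "((F \<circ> real_of_ereal) \<longlongrightarrow> F R) (at_right (ereal R))"
      using DERIV_isCont[OF DF[of R]]
      by (simp add: ereal_tendsto_simps isCont_def filterlim_at_split)
    have A0: "((\<lambda>y. A / y\<^sup>2) \<longlongrightarrow> 0) at_top"
      by (intro tendsto_divide_0[OF tendsto_const] filterlim_at_top_imp_at_infinity
          filterlim_pow_at_top filterlim_ident) auto
    have "((\<lambda>y. sqrt (C - A / y\<^sup>2)) \<longlongrightarrow> sqrt (C - 0)) at_top"
      by (intro tendsto_intros A0)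
    then have "filterlim (\<lambda>y. C * (y * sqrt (C - A / y\<^sup>2))) at_top at_top"
      using assms
      by (intro filterlim_tendsto_pos_mult_at_top[OF tendsto_const]
          filterlim_at_top_mult_tendsto_pos[where c = "sqrt C"] filterlim_ident) auto
    then have "((\<lambda>y. - (a / (C * (y * sqrt (C - A / y\<^sup>2))))) \<longlongrightarrow> - 0) at_top"
      by (intro tendsto_minus tendsto_divide_0[OF tendsto_const] filterlim_at_top_imp_at_infinity)
    then show "((F \<circ> real_of_ereal) \<longlongrightarrow> 0) (at_left \<infinity>)"
      by (simp add: ereal_tendsto_simps F_def)
  qed (use DF assms in \<open>auto simp: less_imp_le\<close>)
  then show ?thesis by (simp add: F_def algebra_simps)
qed

text \<open>The integrand is \<open>z / sqrt (z\<^sup>2 - 1)\<close>, with primitive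
  \<open>sqrt (z\<^sup>2 - 1)\<close>. It is singular at 1, so the version of the fundamental
  theorem for nonnegative functions on an open interval is applied.\<close>

lemma LBINT_inverse_sqrt:
  fixes b :: real
  assumes "b > 1"
  shows "(LBINT z=1..ereal b. 1 / sqrt (1 - 1 / z\<^sup>2)) = sqrt (b\<^sup>2 - 1)"
proof -
  have pos: "1 - 1 / z\<^sup>2 > 0" "z\<^sup>2 - 1 > 0" if "z > 1" for z :: real
    using one_less_power[OF that, of 2] by (auto simp: divide_less_eq)
  define F where "F = (\<lambda>z::real. sqrt (z\<^sup>2 - 1))"
  \<comment> \<open>The real \<open>sqrt\<close> is continuous on the whole line, also at and below
    0, so the endpoint 1 needs no separate limit argument.\<close>
  have cF: "isCont F z" for z
    unfolding F_def by (intro continuous_intros)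
  have "(LBINT z=ereal 1..ereal b. 1 / sqrt (1 - 1 / z\<^sup>2)) = F b - F 1"
  proof (rule interval_integral_FTC_nonneg(2))
    fix z assume "ereal 1 < ereal z"
    then have z: "z > 1" by simp
    have D: "(F has_real_derivative inverse (sqrt (z\<^sup>2 - 1)) / 2 * (2 * z)) (at z)"
      unfolding F_def
      by (rule DERIV_chain2[where f = sqrt and g = "\<lambda>z. z\<^sup>2 - 1", OF DERIV_real_sqrt[OF pos(2)[OF z]]])
        (auto intro!: derivative_eq_intros)
    have eq: "sqrt (1 - 1 / z\<^sup>2) = sqrt (z\<^sup>2 - 1) / z"
    proof -
      have "1 - 1 / z\<^sup>2 = (z\<^sup>2 - 1) / z\<^sup>2" using z by (simp add: diff_divide_distrib)
      then show ?thesis using z by (simp add: real_sqrt_divide)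
    qed
    show "(F has_real_derivative 1 / sqrt (1 - 1 / z\<^sup>2)) (at z)"
      using D by (simp add: eq inverse_eq_divide)
    have "z\<^sup>2 \<noteq> 1"
      using pos(2)[OF z] by linarith
    with z show "isCont (\<lambda>z. 1 / sqrt (1 - 1 / z\<^sup>2)) z"
      by (intro continuous_intros) auto
  next
    show "((F \<circ> real_of_ereal) \<longlongrightarrow> F 1) (at_right (ereal 1))"
         "((F \<circ> real_of_ereal) \<longlongrightarrow> F b) (at_left (ereal b))"
      using cF by (simp_all add: ereal_tendsto_simps isCont_def filterlim_at_split)
    show "AE z in lborel. ereal 1 < ereal z \<longrightarrow> ereal z < ereal b \<longrightarrow> 0 \<le> 1 / sqrt (1 - 1 / z\<^sup>2)"
      using pos(1) by (auto intro!: AE_I2 simp: less_imp_le)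
  qed (use assms in auto)
  then show ?thesis by (simp add: F_def one_ereal_def)
qed

section \<open>Sign of \<open>A_fun\<close> and derivatives of \<open>A_fun\<close>,
  \<open>C_fun\<close> and \<open>t_star\<close>\<close>

lemma A_fun_nonneg:
  assumes "\<And>r. 0 \<le> r \<Longrightarrow> 0 \<le> rho0 r" "r > 0"
  shows "A_fun lam rho0 r \<ge> 0"
proof -
  have "(LBINT s=0..ereal r. rho0 s * s ^ 3) = (LBINT s:{0<..<r}. rho0 s * s ^ 3)"
    using assms(2) by (simp add: interval_lebesgue_integral_def zero_ereal_def)
  also have "\<dots> \<ge> 0"
    unfolding set_lebesgue_integral_def
    by (intro Bochner_Integration.integral_nonneg) (auto simp: indicator_def assms)
  finally show ?thesis by (simp add: A_fun_def mass0_def)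
qed

lemma A_fun_has_real_derivative:
  assumes "continuous_on {0..} rho0" "r > 0"
  shows "(A_fun lam rho0 has_real_derivative \<bar>lam\<bar> * (rho0 r * r ^ 3)) (at r)"
proof -
  \<comment> \<open>The interval extends beyond \<open>r\<close> so that \<open>r\<close> is an
    interior point and the one-sided derivative becomes a full one.\<close>
  have "continuous_on {0..r+1} (\<lambda>s. rho0 s * s ^ 3)"
    by (intro continuous_intros continuous_on_subset[OF assms(1)]) auto
  from interval_integral_FTC2[OF _ _ this, of 0 r] assms(2)
  have "(mass0 rho0 has_real_derivative rho0 r * r ^ 3) (at r within {0..r+1})"
    by (simp add: mass0_def[abs_def] has_real_derivative_iff_has_vector_derivative zero_ereal_def)
  moreover have "at r within {0..r+1} = at r"
    using assms(2) by (intro at_within_interior) auto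
  ultimately show ?thesis
    unfolding A_fun_def[abs_def] by (auto intro: DERIV_cmult)
qed

lemma C_fun_has_real_derivative:
  assumes "(A_fun lam rho0 has_real_derivative a) (at r)" "(v0 has_real_derivative v') (at r)" "r > 0"
  shows "(C_fun lam rho0 v0 has_real_derivative
    2 * v0 r * v' + a / r\<^sup>2 - 2 * A_fun lam rho0 r / r ^ 3) (at r)"
  unfolding C_fun_def[abs_def]
  using assms(3)
  by (auto intro!: derivative_eq_intros assms(1,2) simp: field_simps power_numeral_reduce)

text \<open>For the upper limit \<open>b\<close>, the relation
  \<open>C * r\<^sup>2 = (r * v0 r)\<^sup>2 + A\<close> gives
  \<open>b\<^sup>2 - 1 = (r * v0 r)\<^sup>2 / A\<close>. The factor \<open>sqrt A\<close> then
  cancels against the prefactor, and \<open>v0 r < 0\<close> fixes the sign.\<close>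

lemma t_star_eq:
  assumes "v0 r < 0" "A_fun lam rho0 r > 0" "r > 0"
  shows "t_star lam rho0 v0 r = - r * v0 r / C_fun lam rho0 v0 r"
proof -
  define A C where "A = A_fun lam rho0 r" and "C = C_fun lam rho0 v0 r"
  have A: "A > 0" and C: "C = (v0 r)\<^sup>2 + A / r\<^sup>2" "C > 0"
    using assms by (auto simp: A_def C_def C_fun_def add_nonneg_pos)
  define b where "b = r * (A / C) powr (-1/2)"
  have b_eq: "b = r * sqrt (C / A)"
    using A C by (simp add: b_def powr_minus_divide powr_half_sqrt real_sqrt_divide)
  have b2: "b\<^sup>2 - 1 = (r * v0 r)\<^sup>2 / A"
    using A C(2) assms(3) by (simp add: b_eq power_mult_distrib C(1) field_simps)
  have "(r * v0 r)\<^sup>2 / A > 0"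
    using A assms by simp
  then have "b\<^sup>2 > 1\<^sup>2" using b2 by simp
  moreover have "b \<ge> 0"
    using assms(3) by (simp add: b_def)
  ultimately have "b > 1"
    by (rule power2_less_imp_less)
  from LBINT_inverse_sqrt[OF this]
  have "t_star lam rho0 v0 r = sqrt (A / C\<^sup>2) * sqrt ((r * v0 r)\<^sup>2 / A)"
    by (simp only: t_star_def Let_def A_def[symmetric] C_def[symmetric] b_def[symmetric] b2)
  also have "\<dots> = \<bar>r * v0 r\<bar> / C"
    using A C(2) by (simp add: real_sqrt_divide)
  finally show ?thesis
    using assms by (simp add: C_def abs_mult)
qed

lemma deriv_t_star:
  assumes A': "(A_fun lam rho0 has_real_derivative a) (at R)"
    and v': "(v0 has_real_derivative v') (at R)"
    and C': "(C_fun lam rho0 v0 has_real_derivative c) (at R)"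
    and "v0 R < 0" "A_fun lam rho0 R > 0" "R > 0"
  defines "C \<equiv> C_fun lam rho0 v0 R"
  shows "deriv (t_star lam rho0 v0) R = - (v0 R + R * v') / C + R * v0 R * c / C\<^sup>2"
proof -
  have C: "C > 0"
    using assms by (auto simp: C_def C_fun_def add_nonneg_pos)
  \<comment> \<open>The closed form is valid only where \<open>v0 < 0 < A\<close>. Both signs
    persist near \<open>R\<close> by continuity, so the closed form may be differentiated
    instead.\<close>
  have "\<forall>\<^sub>F r in nhds R. v0 r < 0"
    using DERIV_isCont[OF v'] \<open>v0 R < 0\<close> by (simp add: isCont_def tendsto_nhds_iff order_tendstoD(2))
  moreover have "\<forall>\<^sub>F r in nhds R. A_fun lam rho0 r > 0"
    using DERIV_isCont[OF A'] \<open>A_fun lam rho0 R > 0\<close>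
    by (simp add: isCont_def tendsto_nhds_iff order_tendstoD(1))
  moreover have "\<forall>\<^sub>F r in nhds R. r > 0"
    using \<open>R > 0\<close> by (intro eventually_nhds_in_open[of "{0<..}", simplified]) auto
  ultimately have ev: "\<forall>\<^sub>F r in nhds R. t_star lam rho0 v0 r = - r * v0 r / C_fun lam rho0 v0 r"
    by eventually_elim (rule t_star_eq)
  have "((\<lambda>r. - r * v0 r / C_fun lam rho0 v0 r) has_real_derivative
      ((- 1 * v0 R + v' * (- R)) * C - (- R * v0 R) * c) / (C * C)) (at R)"
    using C unfolding C_def by (intro derivative_intros v' C') auto
  then have "(t_star lam rho0 v0 has_real_derivative
      ((- 1 * v0 R + v' * (- R)) * C - (- R * v0 R) * c) / (C * C)) (at R)"
    using DERIV_cong_ev[OF refl ev refl] by blast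
  then show ?thesis
    using C by (simp add: DERIV_imp_deriv field_simps power2_eq_square)
qed

section \<open>Algebraic identities behind the comparison of the conditions\<close>

lemma velocity_identity:
  fixes R C c v v' A a :: real
  assumes "R > 0" "C = v\<^sup>2 + A / R\<^sup>2" "c = 2 * v * v' + a / R\<^sup>2 - 2 * A / R ^ 3"
  shows "2 * R * v * (v + v' * R) = 2 * R * C + c * R\<^sup>2 - a"
  \<comment> \<open>The terms \<open>2 * A / R\<close> coming from \<open>2 * R * C\<close> and from
    \<open>c * R\<^sup>2\<close> cancel; what remains no longer involves \<open>A\<close>.\<close>
  using assms(1) unfolding assms(2,3) by (simp add: field_simps power2_eq_square power3_eq_cube)

text \<open>For \<open>k = sqrt (2 * R / c)\<close> one has \<open>c * k\<^sup>2 = 2 * R\<close> and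
  \<open>sqrt (2 * R * c) = k * c\<close>. The square root is thus the cross term of a completed
  square.\<close>

lemma criterion_identity:
  fixes R C c q v A a :: real
  assumes "R > 0" "c > 0" "C * R\<^sup>2 = (R * v)\<^sup>2 + A" "2 * R * v * q = 2 * R * C + c * R\<^sup>2 - a"
  shows "2 * C * R * v * (q + sqrt (2 * R * c))
    = c * ((C * sqrt (2 * R / c) + R * v)\<^sup>2 - (C * a / c - A))"
proof -
  define k where "k = sqrt (2 * R / c)"
  have k2: "c * k\<^sup>2 = 2 * R"
    using assms(1,2) by (simp add: k_def)
  have "sqrt (2 * R * c) = sqrt (2 * R / c * c\<^sup>2)"
    using assms(2) by (simp add: power2_eq_square)
  then have sq: "sqrt (2 * R * c) = k * c"
    using assms(2) by (simp only: real_sqrt_mult k_def real_sqrt_abs abs_of_pos)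
  have "c * ((C * k + R * v)\<^sup>2 - (C * a / c - A))
      = C\<^sup>2 * (c * k\<^sup>2) + 2 * c * C * k * R * v + c * ((R * v)\<^sup>2 + A) - C * a"
    using assms(2) by (simp add: field_simps power2_eq_square)
  also have "\<dots> = C * (2 * R * C + c * R\<^sup>2 - a) + 2 * c * C * k * R * v"
    unfolding k2 assms(3)[symmetric] by (simp add: algebra_simps power2_eq_square)
  also have "\<dots> = 2 * C * R * v * (q + k * c)"
    unfolding assms(4)[symmetric] by (simp add: algebra_simps)
  finally show ?thesis
    by (simp add: sq k_def)
qed

text \<open>Put \<open>K = C * sqrt (2 * R / c)\<close>. Since
  \<open>c * K\<^sup>2 = 2 * R * C\<^sup>2\<close>, the term \<open>1 / w\<close> is the
  \<open>K\<^sup>2\<close> part; the other terms form a perfect square once \<open>a\<close> is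
  expressed through \<open>s\<^sup>2\<close>.\<close>

lemma integral_condition_identity:
  fixes R C c w s A a :: real
  assumes "R > 0" "C > 0" "c > 0" "w > 0" "C * R\<^sup>2 = (R * w)\<^sup>2 + A" "s\<^sup>2 = C * a / c - A"
  shows "1 / w + 1 / 2 * (2 * c * s / C\<^sup>2 - c / C\<^sup>2 * (R * w - A / (R * w)) - a / (C * R * w))
    = c / (2 * R * w * C\<^sup>2) * ((C * sqrt (2 * R / c))\<^sup>2 - (s - R * w)\<^sup>2)"
proof -
  have a: "a = c * (s\<^sup>2 + A) / C"
    using assms(2,3,6) by (simp add: field_simps)
  have "(C * sqrt (2 * R / c))\<^sup>2 = 2 * R * C\<^sup>2 / c"
    using assms(1,3) by (simp add: power_mult_distrib)
  then show ?thesis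
    unfolding a using assms(1-4) by (simp add: field_simps power2_eq_square)
qed

text \<open>The subtracted term is \<open>2 * t_star'\<close> at velocity \<open>- w\<close>. The
  velocity identity reads \<open>- 2 * R * w * C * q = c * (K\<^sup>2 + (R * w)\<^sup>2 -
  s\<^sup>2)\<close>; eliminating \<open>q\<close> with it reverses the sign of
  \<open>K\<^sup>2\<close> and turns \<open>s - R * w\<close> into \<open>s + R * w\<close>.\<close>

lemma delayed_condition_identity:
  fixes R C c w q s A a :: real
  assumes "R > 0" "C > 0" "c > 0" "w > 0" "C * R\<^sup>2 = (R * w)\<^sup>2 + A" "s\<^sup>2 = C * a / c - A"
    and "2 * R * (- w) * q = 2 * R * C + c * R\<^sup>2 - a"
  shows "c / (2 * R * w * C\<^sup>2) * ((C * sqrt (2 * R / c))\<^sup>2 - (s - R * w)\<^sup>2)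
      - 2 * (- q / C + R * (- w) * c / C\<^sup>2)
    = c / (2 * R * w * C\<^sup>2) * ((s + R * w)\<^sup>2 - (C * sqrt (2 * R / c))\<^sup>2)"
proof -
  define K where "K = C * sqrt (2 * R / c)"
  have K: "c * K\<^sup>2 = 2 * R * C\<^sup>2"
    using assms(1,3) by (simp add: K_def power_mult_distrib)
  have a: "C * a = c * (s\<^sup>2 + A)"
    using assms(2,3,6) by (simp add: field_simps)
  have "- 4 * R * w * C * q = 2 * (2 * R * C\<^sup>2 + c * (C * R\<^sup>2) - C * a)"
    using arg_cong[OF assms(7), of "\<lambda>x. 2 * C * x"] by (simp add: algebra_simps power2_eq_square)
  also have "\<dots> = 2 * (c * K\<^sup>2 + c * ((R * w)\<^sup>2 + A) - c * (s\<^sup>2 + A))"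
    by (simp add: K a assms(5))
  finally have q: "c * (K\<^sup>2 - (s - R * w)\<^sup>2) + 4 * R * w * C * q + 4 * (R * w)\<^sup>2 * c
      = c * ((s + R * w)\<^sup>2 - K\<^sup>2)"
    by (simp add: algebra_simps power2_eq_square)
  have "c / (2 * R * w * C\<^sup>2) * (K\<^sup>2 - (s - R * w)\<^sup>2) - 2 * (- q / C + R * (- w) * c / C\<^sup>2)
      = (c * (K\<^sup>2 - (s - R * w)\<^sup>2) + 4 * R * w * C * q + 4 * (R * w)\<^sup>2 * c) / (2 * R * w * C\<^sup>2)"
    using assms(1,2,4) by (simp add: divide_simps) (simp add: algebra_simps power2_eq_square)
  also have "\<dots> = c / (2 * R * w * C\<^sup>2) * ((s + R * w)\<^sup>2 - K\<^sup>2)"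
    unfolding q by simp
  finally show ?thesis
    unfolding K_def .
qed

section \<open>Case analysis on the signs of the velocity and of \<open>C'\<close>\<close>

theorem corollary1p11:
  fixes lam R :: real and rho0 v0 :: "real \<Rightarrow> real"
  assumes "continuous_on {0..} rho0" and "\<And>r. 0 \<le> r \<Longrightarrow> 0 \<le> rho0 r"
    and "continuous_on {0..} v0" and "v0 C1_differentiable_on {0<..}" and "v0 0 = 0"
    and "lam < 0" and "R > 0"
  shows "PCFB lam rho0 v0 R \<longleftrightarrow>
      A_fun lam rho0 R = 0 \<and> v0 R < 0
    \<or> deriv (C_fun lam rho0 v0) R < 0
    \<or> deriv (C_fun lam rho0 v0) R = 0 \<and> v0 R + deriv v0 R * R < 0
    \<or> deriv (C_fun lam rho0 v0) R > 0 \<and>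
        v0 R + deriv v0 R * R \<le> - sqrt (2 * R * deriv (C_fun lam rho0 v0) R)"
proof -
  define v v' A a C c t' where "v = v0 R" and "v' = deriv v0 R"
    and "A = A_fun lam rho0 R" and "a = deriv (A_fun lam rho0) R"
    and "C = C_fun lam rho0 v0 R" and "c = deriv (C_fun lam rho0 v0) R"
    and "t' = deriv (t_star lam rho0 v0) R"
  note defs = v_def v'_def A_def a_def C_def c_def t'_def
  define w q where "w = \<bar>v\<bar>" and "q = v + v' * R"
  have R: "R > 0" by fact
  have A: "A \<ge> 0"
    using A_fun_nonneg assms(2) R by (simp add: A_def)
  have DA: "(A_fun lam rho0 has_real_derivative \<bar>lam\<bar> * (rho0 R * R ^ 3)) (at R)"
    by (rule A_fun_has_real_derivative) (use assms(1) R in auto)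
  have a_eq: "a = \<bar>lam\<bar> * (rho0 R * R ^ 3)"
    using DA by (simp add: a_def DERIV_imp_deriv)
  then have a: "a \<ge> 0"
    using assms(2)[of R] R by simp
  have "v0 differentiable at R"
    using assms(4) R by (auto simp: C1_differentiable_on_eq)
  then have Dv: "(v0 has_real_derivative v') (at R)"
    unfolding v'_def
    by (metis DERIV_deriv_iff_real_differentiable)
  have DC: "(C_fun lam rho0 v0 has_real_derivative 2 * v * v' + a / R\<^sup>2 - 2 * A / R ^ 3) (at R)"
    using C_fun_has_real_derivative[OF DA Dv R] by (simp add: v_def A_def a_eq)
  then have c_eq: "c = 2 * v * v' + a / R\<^sup>2 - 2 * A / R ^ 3"
    unfolding c_def by (rule DERIV_imp_deriv)
  have C_eq: "C = v\<^sup>2 + A / R\<^sup>2"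
    by (simp add: C_def C_fun_def A_def v_def)
  have vq: "2 * R * v * q = 2 * R * C + c * R\<^sup>2 - a"
    unfolding q_def by (rule velocity_identity[OF R C_eq c_eq])
  have CR: "C * R\<^sup>2 = (R * v)\<^sup>2 + A" "C * R\<^sup>2 = (R * w)\<^sup>2 + A"
    using R by (simp_all add: C_eq w_def power_mult_distrib algebra_simps)
  have sqrt_R: "sqrt (C - A / R\<^sup>2) = w"
    by (simp add: C_eq w_def)
  have C_pos: "C > 0" and rad_pos: "C - A / R\<^sup>2 > 0" and w: "w > 0" if "v \<noteq> 0"
    using that A R by (simp_all add: C_eq w_def add_pos_nonneg)

  define K \<sigma> where "K = C * sqrt (2 * R / c)" and "\<sigma> = C * a / c - A"
  have crit: "2 * C * R * v * (q + sqrt (2 * R * c)) = c * ((K + R * v)\<^sup>2 - \<sigma>)" if "c > 0"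
    unfolding K_def \<sigma>_def by (rule criterion_identity[OF R that CR(1) vq])
  define I where "I = (LBINT y=ereal R..ereal (sqrt (a / c)). (c - a / y\<^sup>2) / (C - A / y\<^sup>2) powr (3/2))"
  have I: "1 / w + 1 / 2 * I = c / (2 * R * w * C\<^sup>2) * (K\<^sup>2 - (sqrt \<sigma> - R * w)\<^sup>2)"
    if "v \<noteq> 0" "c > 0" "\<sigma> > 0"
  proof -
    \<comment> \<open>\<open>\<sigma> > 0\<close> forces \<open>a > 0\<close>, so the critical point
      \<open>sqrt (a / c)\<close> is positive and the closed form applies.\<close>
    have "C * a / c > 0"
      using that(3) A unfolding \<sigma>_def by linarith
    then have a': "a > 0"
      using C_pos that(1,2) by (simp add: zero_less_divide_iff zero_less_mult_iff)
    note LBINT_to_critical_point[OF A C_pos R that(2) a' rad_pos, OF that(1,1),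
        folded \<sigma>_def I_def, OF that(3), unfolded sqrt_R]
    moreover have "(sqrt \<sigma>)\<^sup>2 = C * a / c - A"
      using that(3) by (simp add: \<sigma>_def)
    ultimately show ?thesis
      using integral_condition_identity[OF R C_pos that(2) w CR(2), OF that(1,1), of "sqrt \<sigma>" a]
      by (simp only: K_def)
  qed
  have coeff: "c / (2 * R * w * C\<^sup>2) * x \<le> 0 \<longleftrightarrow> x \<le> 0" if "v \<noteq> 0" "c > 0" for x
  proof -
    have "c / (2 * R * w * C\<^sup>2) > 0"
      using that C_pos w R by simp
    then show ?thesis by (simp only: mult_le_0_iff) auto
  qed
  have K: "K > 0" if "v \<noteq> 0" "c > 0"
    using that C_pos R by (simp add: K_def)
  \<comment> \<open>Here \<open>(R * w)\<^sup>2 - \<sigma> = C * (R\<^sup>2 - a / c)\<close>: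
    comparing \<open>\<sigma>\<close> with \<open>(R * w)\<^sup>2\<close> locates the critical point
    relative to \<open>R\<close>.\<close>
  have \<sigma>_iff: "(R * w)\<^sup>2 < \<sigma> \<longleftrightarrow> c < a / R\<^sup>2" "\<sigma> < (R * w)\<^sup>2 \<longleftrightarrow> a / R\<^sup>2 < c" if "v \<noteq> 0" "c > 0"
  proof -
    have "(c - a / R\<^sup>2) * (C * R\<^sup>2 / c) = C * R\<^sup>2 - C * a / c"
      using R that by (simp add: field_simps)
    then have "(R * w)\<^sup>2 - \<sigma> = (c - a / R\<^sup>2) * (C * R\<^sup>2 / c)"
      using CR(2) by (simp add: \<sigma>_def)
    moreover have "C * R\<^sup>2 / c > 0"
      using that C_pos R by simp
    ultimately have "(R * w)\<^sup>2 - \<sigma> < 0 \<longleftrightarrow> c - a / R\<^sup>2 < 0" "(R * w)\<^sup>2 - \<sigma> > 0 \<longleftrightarrow> c - a / R\<^sup>2 > 0"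
      by (metis mult_less_0_iff less_asym, metis zero_less_mult_iff less_asym)
    then show "(R * w)\<^sup>2 < \<sigma> \<longleftrightarrow> c < a / R\<^sup>2" "\<sigma> < (R * w)\<^sup>2 \<longleftrightarrow> a / R\<^sup>2 < c"
      by linarith+
  qed
  have Rw: "R * w \<ge> 0" using R by (simp add: w_def)

  have PCFB_eq: "PCFB lam rho0 v0 R \<longleftrightarrow>
      v > 0 \<and> (c < 0
        \<or> c = 0 \<and> 1 / v - a / 2 * (LBINT y=ereal R..\<infinity>. (1 / y\<^sup>2) / (C - A / y\<^sup>2) powr (3/2)) < 0
        \<or> 0 < c \<and> c < a / R\<^sup>2 \<and> 1 / v + 1 / 2 * I \<le> 0)
      \<or> v = 0 \<and> (c < 0 \<or> c = 0 \<and> v' * R < 0 \<or> c > 0 \<and> v' * R \<le> - sqrt (2 * R * c))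
      \<or> v < 0 \<and> (A = 0 \<or> c < 0
        \<or> c = 0 \<and> 1 / \<bar>v\<bar> - 1 / 2 * (LBINT y=ereal R..\<infinity>. (a / y\<^sup>2) / (C - A / y\<^sup>2) powr (3/2)) < 2 * t'
        \<or> 0 < c \<and> c \<le> a / R\<^sup>2 \<and> 1 / \<bar>v\<bar> + 1 / 2 * I \<le> 2 * t'
        \<or> a / R\<^sup>2 < c \<and> c < a * (1 / R\<^sup>2 + v\<^sup>2 / A) \<and> 1 / \<bar>v\<bar> + 1 / 2 * I \<le> max 0 (2 * t')
        \<or> a * (1 / R\<^sup>2 + v\<^sup>2 / A) \<le> c)"
    unfolding PCFB_def Let_def I_def defs ..

  have "PCFB lam rho0 v0 R \<longleftrightarrow>
      A = 0 \<and> v < 0 \<or> c < 0 \<or> c = 0 \<and> q < 0 \<or> c > 0 \<and> q \<le> - sqrt (2 * R * c)"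
  proof (cases v "0 :: real" rule: linorder_cases)
    case equal
    then show ?thesis unfolding PCFB_eq by (auto simp: q_def)
  next
    case greater
    then have v: "v \<noteq> 0" "w = v" by (auto simp: w_def)
    consider "c < 0" | "c = 0" | "c > 0" by linarith
    then show ?thesis
    proof cases
      case 1
      then show ?thesis using greater unfolding PCFB_eq by auto
    next
      case 2
      \<comment> \<open>At \<open>c = 0\<close> the closed form and the velocity identity reduce the
        left-hand side to \<open>q / C\<close>.\<close>
      have "1 / v - a / 2 * (LBINT y=ereal R..\<infinity>. (1 / y\<^sup>2) / (C - A / y\<^sup>2) powr (3/2))
          = 1 / v - a / 2 * (1 / (C * R * v))"
        using LBINT_to_infinity[OF A C_pos R _ rad_pos, of 1] v by (simp add: sqrt_R)
      also have "\<dots> = (2 * R * C - a) / (2 * C * R * v)"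
        using greater R C_pos v by (simp add: field_simps)
      also have "2 * R * C - a = 2 * R * v * q"
        using vq 2 by simp
      also have "2 * R * v * q / (2 * C * R * v) = q / C"
        using v R by simp
      finally show ?thesis
        using greater 2 C_pos v unfolding PCFB_eq by (auto simp: divide_less_0_iff)
    next
      case 3
      have "q \<le> - sqrt (2 * R * c) \<longleftrightarrow> 2 * C * R * v * (q + sqrt (2 * R * c)) \<le> 0"
        using greater R C_pos v by (auto simp: mult_le_0_iff)
      also have "\<dots> \<longleftrightarrow> (K + R * v)\<^sup>2 \<le> \<sigma>"
        unfolding crit[OF 3] using 3 by (auto simp: mult_le_0_iff)
      finally have crit': "q \<le> - sqrt (2 * R * c) \<longleftrightarrow> (K + R * v)\<^sup>2 \<le> \<sigma>" .
      have Kv: "K > 0" "R * v > 0" using K v 3 R greater by auto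
      show ?thesis
      proof (cases "c < a / R\<^sup>2")
        case True
        then have s: "(R * v)\<^sup>2 < \<sigma>"
          using \<sigma>_iff v 3 by simp
        then have \<sigma>: "\<sigma> > 0"
          by (rule le_less_trans[rotated]) simp
        have s': "R * v < sqrt \<sigma>"
          using s by (rule real_less_rsqrt)
        have "1 / v + 1 / 2 * I \<le> 0 \<longleftrightarrow> K\<^sup>2 \<le> (sqrt \<sigma> - R * v)\<^sup>2"
          unfolding I[OF v(1) 3 \<sigma>, unfolded v(2)] coeff[OF v(1) 3, unfolded v(2)] by simp
        also have "\<dots> \<longleftrightarrow> K + R * v \<le> sqrt \<sigma>"
          using power_mono_iff[of K "sqrt \<sigma> - R * v" 2] Kv s' by auto
        also have "\<dots> \<longleftrightarrow> (K + R * v)\<^sup>2 \<le> \<sigma>"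
          using power_mono_iff[of "K + R * v" "sqrt \<sigma>" 2] Kv \<sigma> by simp
        finally show ?thesis
          using greater 3 True crit' unfolding PCFB_eq by auto
      next
        case False
        \<comment> \<open>No clause of \<open>PCFB\<close> covers
          \<open>c \<ge> a / R\<^sup>2\<close> for positive velocity. The criterion fails as well,
          because \<open>\<sigma> \<le> (R * v)\<^sup>2\<close>.\<close>
        have "(R * v)\<^sup>2 < (K + R * v)\<^sup>2"
          using Kv by (intro power_strict_mono) auto
        then have "\<not> (K + R * v)\<^sup>2 \<le> \<sigma>"
          using False \<sigma>_iff(1)[OF v(1) 3] v(2) by auto
        then show ?thesis
          using greater 3 False crit' unfolding PCFB_eq by auto
      qed
    qed
  next
    case less
    then have v: "v \<noteq> 0" "v = - w" by (auto simp: w_def)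
    show ?thesis
    proof (cases "A = 0")
      case True
      then show ?thesis using less unfolding PCFB_eq by auto
    next
      case False
      with A have A': "A > 0" by simp
      have t': "t' = - q / C + R * v * c / C\<^sup>2"
        using deriv_t_star[OF DA Dv DC] less A' R
        by (simp add: t'_def v_def A_def C_def c_eq q_def mult.commute)
      \<comment> \<open>In this form the threshold says \<open>c < a * C / A\<close> exactly when
        \<open>\<sigma> > 0\<close>, for \<open>c > 0\<close>.\<close>
      have bound: "a * (1 / R\<^sup>2 + v\<^sup>2 / A) = a * C / A"
        using A' by (simp add: C_eq field_simps)
      consider "c < 0" | "c = 0" | "c > 0" by linarith
      then show ?thesis
      proof cases
        case 1
        then show ?thesis using less unfolding PCFB_eq by auto
      next
        case 2
        \<comment> \<open>The integral part contributes \<open>- q / C\<close> and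
          \<open>- 2 * t'\<close> contributes \<open>2 * q / C\<close>.\<close>
        have "1 / w - 1 / 2 * (LBINT y=ereal R..\<infinity>. (a / y\<^sup>2) / (C - A / y\<^sup>2) powr (3/2)) - 2 * t'
            = 1 / w - 1 / 2 * (a / (C * R * w)) + 2 * q / C"
          using LBINT_to_infinity[OF A C_pos R a rad_pos] v 2 by (simp add: sqrt_R t')
        also have "\<dots> = (2 * R * C - a) / (2 * C * R * w) + 2 * q / C"
          using w v R C_pos by (simp add: field_simps)
        also have "2 * R * C - a = - (2 * R * w * q)"
          using vq v(2) 2 by simp
        also have "- (2 * R * w * q) / (2 * C * R * w) + 2 * q / C = q / C"
          using w v(1) R C_pos by (simp add: field_simps)
        finally have "1 / w - 1 / 2 * (LBINT y=ereal R..\<infinity>. (a / y\<^sup>2) / (C - A / y\<^sup>2) powr (3/2)) < 2 * t'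
            \<longleftrightarrow> q / C < 0"
          by linarith
        also have "\<dots> \<longleftrightarrow> q < 0"
          using C_pos v by (simp add: divide_less_0_iff)
        finally have cond: "1 / \<bar>v\<bar> - 1 / 2 * (LBINT y=ereal R..\<infinity>. (a / y\<^sup>2) / (C - A / y\<^sup>2) powr (3/2))
            < 2 * t' \<longleftrightarrow> q < 0"
          by (simp add: w_def)
        \<comment> \<open>The last clause of \<open>PCFB\<close> does not require
          \<open>c > 0\<close>. At \<open>c = 0\<close> it can hold only with \<open>a = 0\<close>,
          and then \<open>v * q = C > 0\<close> with \<open>v < 0\<close> gives the required
          sign.\<close>
        have "q < 0" if "a * C / A \<le> 0"
        proof -
          have "a = 0"
            using that a A' C_pos v by (simp add: divide_le_0_iff mult_le_0_iff)
          then have "v * q = C"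
            using vq 2 R by simp
          then have "v * q > 0"
            using C_pos v(1) by simp
          then show ?thesis
            using less by (simp add: zero_less_mult_iff)
        qed
        moreover have "\<not> a / R\<^sup>2 < 0" using a by (simp add: not_less)
        ultimately show ?thesis
          using less 2 False cond unfolding PCFB_eq bound by auto
      next
        case 3
        have "q \<le> - sqrt (2 * R * c) \<longleftrightarrow> 0 \<le> 2 * C * R * v * (q + sqrt (2 * R * c))"
          using less R C_pos v(1) by (auto simp: zero_le_mult_iff mult_le_0_iff)
        also have "\<dots> \<longleftrightarrow> \<sigma> \<le> (K - R * w)\<^sup>2"
          unfolding crit[OF 3] using 3 v(2) by (auto simp: zero_le_mult_iff)
        finally have crit': "q \<le> - sqrt (2 * R * c) \<longleftrightarrow> \<sigma> \<le> (K - R * w)\<^sup>2" .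
        have Kw: "K > 0" "R * w > 0" using K w v(1) 3 R by auto
        show ?thesis
        proof (cases "\<sigma> > 0")
          case True
          define s where "s = sqrt \<sigma>"
          have s: "s > 0" "s\<^sup>2 = \<sigma>" using True by (auto simp: s_def)
          have crit_s: "q \<le> - sqrt (2 * R * c) \<longleftrightarrow> s \<le> \<bar>K - R * w\<bar>"
            unfolding crit' s(2)[symmetric] using power_mono_iff[of s "\<bar>K - R * w\<bar>" 2] s(1) by simp
          have I_s: "1 / \<bar>v\<bar> + 1 / 2 * I = c / (2 * R * w * C\<^sup>2) * (K\<^sup>2 - (s - R * w)\<^sup>2)"
            using I[OF v(1) 3 True] by (simp add: s_def w_def)
          have le_0: "1 / \<bar>v\<bar> + 1 / 2 * I \<le> 0 \<longleftrightarrow> K \<le> \<bar>s - R * w\<bar>"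
            unfolding I_s coeff[OF v(1) 3] using power_mono_iff[of K "\<bar>s - R * w\<bar>" 2] Kw by simp
          have "2 * R * (- w) * q = 2 * R * C + c * R\<^sup>2 - a"
            using vq v(2) by simp
          from delayed_condition_identity[OF R C_pos[OF v(1)] 3 w[OF v(1)] CR(2) s(2)[unfolded \<sigma>_def] this,
              folded v(2) K_def]
          have "1 / \<bar>v\<bar> + 1 / 2 * I - 2 * t' = c / (2 * R * w * C\<^sup>2) * ((s + R * w)\<^sup>2 - K\<^sup>2)"
            unfolding I_s t' .
          then have "1 / \<bar>v\<bar> + 1 / 2 * I \<le> 2 * t'
              \<longleftrightarrow> c / (2 * R * w * C\<^sup>2) * ((s + R * w)\<^sup>2 - K\<^sup>2) \<le> 0"
            by linarith
          also have "\<dots> \<longleftrightarrow> s + R * w \<le> K"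
            unfolding coeff[OF v(1) 3] using power_mono_iff[of "s + R * w" K 2] Kw s(1) by simp
          finally have le_t: "1 / \<bar>v\<bar> + 1 / 2 * I \<le> 2 * t' \<longleftrightarrow> s + R * w \<le> K" .
          have c_less: "c < a * C / A"
            using True A' 3 by (simp add: \<sigma>_def field_simps)
          have c_le: "c \<le> a / R\<^sup>2 \<longleftrightarrow> R * w \<le> s" "a / R\<^sup>2 < c \<longleftrightarrow> \<not> R * w \<le> s"
            using \<sigma>_iff(2)[OF v(1) 3] power_mono_iff[of "R * w" s 2] Rw s by auto
          \<comment> \<open>The maximum with 0 supplies the alternative
            \<open>K \<le> R * w - s\<close>, possible only when \<open>s < R * w\<close>. Together
            with \<open>s + R * w \<le> K\<close> these are the two ways in which
            \<open>s \<le> \<bar>K - R * w\<bar>\<close> can hold.\<close>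
          have "PCFB lam rho0 v0 R \<longleftrightarrow> R * w \<le> s \<and> s + R * w \<le> K
              \<or> \<not> R * w \<le> s \<and> (K \<le> \<bar>s - R * w\<bar> \<or> s + R * w \<le> K)"
            unfolding PCFB_eq bound c_le le_max_iff_disj le_0 le_t
            using less 3 False c_less by simp
          also have "\<dots> \<longleftrightarrow> s \<le> \<bar>K - R * w\<bar>"
            using s(1) Kw by linarith
          finally show ?thesis
            using less 3 False crit_s by simp
        next
          case False
          \<comment> \<open>For \<open>\<sigma> \<le> 0\<close> both sides hold: the last clause of
            \<open>PCFB\<close> applies, and a square is at least \<open>\<sigma>\<close>.\<close>
          then have "a * C / A \<le> c"
            using A' 3 by (simp add: \<sigma>_def field_simps)
          moreover have "\<sigma> \<le> (K - R * w)\<^sup>2"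
            using False zero_le_power2[of "K - R * w"] by linarith
          ultimately show ?thesis
            using less 3 crit' unfolding PCFB_eq bound by auto
        qed
      qed
    qed
  qed
  then show ?thesis
    by (simp only: A_def v_def c_def q_def v'_def)
qed

end
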